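(* The fraction, among the $2^n$ orientations of the path with $n$ edges, of those oriented paths that are tournament Sidorenko (TS) tends to $0$ as $n\to\infty$.
   Context: A weighted tournament on $N$ vertices is a function $A:[N]^2\to[0,1]$ with $A(x,y)+A(y,x)=1$ for all $x,y$ (so $A(x,x)=1/2$). For a digraph $D$ with $v(D)$ vertices and $e(D)$ edges, $h_D(A)=\sum_{\phi:V(D)\to[N]}\prod_{(x,y)\in E(D)}A(\phi(x),\phi(y))$. $D$ is tournament Sidorenko (TS) if $h_D(A)\ge N^{v(D)}/2^{e(D)}$ for every $N$ and every weighted tournament $A$ on $N$ vertices. Each edge of the path on vertices $0,1,\dots,n$ may be oriented left-to-right or right-to-left. *)

theory Defs
  imports Complex_Main "HOL-Library.FuncSet" "Graph_Theory.Pair_Digraph"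
begin

(* The vertex set [N] is {1..N}; values of A outside [N] are irrelevant. *)
definition weighted_tournament :: "nat \<Rightarrow> (nat \<Rightarrow> nat \<Rightarrow> real) \<Rightarrow> bool" where
  "weighted_tournament N A \<longleftrightarrow>
     (\<forall>x\<in>{1..N}. \<forall>y\<in>{1..N}. A x y \<in> {0..1} \<and> A x y + A y x = 1)"

(* Extensional functions, so that each map V(D) -> [N] is counted exactly once. *)
definition hom_weight :: "'a pair_pre_digraph \<Rightarrow> nat \<Rightarrow> (nat \<Rightarrow> nat \<Rightarrow> real) \<Rightarrow> real" where
  "hom_weight D N A =
     (\<Sum>\<phi> \<in> pverts D \<rightarrow>\<^sub>E {1..N}. \<Prod>(x, y)\<in>parcs D. A (\<phi> x) (\<phi> y))"

(* Meant for finite digraphs. The case N = 0 is allowed but imposes no condition. *)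
definition tournament_sidorenko :: "'a pair_pre_digraph \<Rightarrow> bool" where
  "tournament_sidorenko D \<longleftrightarrow>
     (\<forall>N A. weighted_tournament N A \<longrightarrow>
        hom_weight D N A \<ge> real N ^ card (pverts D) / 2 ^ card (parcs D))"

(* R is the set of those i < n whose edge {i, i+1} is oriented left-to-right. *)
definition oriented_path :: "nat \<Rightarrow> nat set \<Rightarrow> nat pair_pre_digraph" where
  "oriented_path n R =
     \<lparr> pverts = {0..n}, parcs = (\<lambda>i. if i \<in> R then (i, Suc i) else (Suc i, i)) ` {..<n} \<rparr>"

(* Labelled orientations: a path and its mirror image count separately. *)
definition path_orientations :: "nat \<Rightarrow> nat pair_pre_digraph set" where
  "path_orientations n = oriented_path n ` Pow {..<n}"

lemma pair_digraph_oriented_path: "pair_digraph (oriented_path n R)"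
  by unfold_locales (auto simp: oriented_path_def split: if_splits)

lemma card_parcs_oriented_path: "card (parcs (oriented_path n R)) = n"
proof -
  have "inj_on (\<lambda>i. if i \<in> R then (i, Suc i) else (Suc i, i)) {..<n}"
    by (auto simp: inj_on_def split: if_splits)
  from card_image[OF this] show ?thesis
    unfolding oriented_path_def pair_pre_digraph.simps by simp
qed

lemma inj_on_oriented_path: "inj_on (oriented_path n) (Pow {..<n})"
proof (rule inj_onI)
  have *: "R = {i. (i, Suc i) \<in> parcs (oriented_path n R)}" if "R \<in> Pow {..<n}" for R
    using that by (auto simp: oriented_path_def image_iff split: if_splits)
  fix R S
  assume "R \<in> Pow {..<n}" "S \<in> Pow {..<n}" "oriented_path n R = oriented_path n S"
  then show "R = S"
    using *[of R] *[of S] by simp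
qed

lemma card_path_orientations: "card (path_orientations n) = 2 ^ n"
  by (simp add: path_orientations_def card_image inj_on_oriented_path card_Pow)

end

(* Already the transitive tournament on two vertices excludes almost all orientations.  Let w_n(x) be
   the weight of the maps of the path on 0..n sending n to x, and put P = w_n(1) + w_n(2),
   Q = w_n(2) - w_n(1).  According to the orientation of edge n, (P, Q) becomes (P - Q/2, P/2) or
   (P + Q/2, -P/2), so P is a positive martingale under uniformly random orientations.  Moreover
   P/3 <= |Q| <= P after the first step, so by strict concavity of the square root the mean of sqrt P
   decays exponentially, whereas being TS forces P >= 2. *)
theory Submission
  imports Defs
begin

section \<open>Transfer recursion for weighted path maps\<close>

definition edge_weight :: "(nat \<Rightarrow> nat \<Rightarrow> real) \<Rightarrow> nat set \<Rightarrow> nat \<Rightarrow> nat \<Rightarrow> nat \<Rightarrow> real" where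
  "edge_weight A R i x y = (if i \<in> R then A x y else A y x)"

primrec path_weight :: "(nat \<Rightarrow> nat \<Rightarrow> real) \<Rightarrow> nat \<Rightarrow> nat set \<Rightarrow> nat \<Rightarrow> nat \<Rightarrow> real" where
  "path_weight A N R 0 x = 1"
| "path_weight A N R (Suc n) x = (\<Sum>y\<in>{1..N}. path_weight A N R n y * edge_weight A R n y x)"

text \<open>Later used to let two orientations that differ only in edge n share the same weights at
  stage n.\<close>

lemma path_weight_cong:
  assumes "R \<inter> {..<n} = S \<inter> {..<n}"
  shows "path_weight A N R n x = path_weight A N S n x"
  using assms
proof (induction n arbitrary: x)
  case (Suc n)
  have "i \<in> R \<longleftrightarrow> i \<in> S" if "i < Suc n" for i
    using Suc.prems that by blast
  then have "R \<inter> {..<n} = S \<inter> {..<n}" "n \<in> R \<longleftrightarrow> n \<in> S"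
    by auto
  then show ?case
    using Suc.IH by (simp add: edge_weight_def)
qed simp

text \<open>The arbitrary test function \<open>g\<close> on the image of the last vertex carries the
  induction: summing out the image \<open>y\<close> of vertex \<open>Suc n\<close> leaves a sum over
  maps of the shorter path, with x \<mapsto> \<open>\<Sum>y. edge_weight A R n x y * g y\<close> as
  the new test function. Taking \<open>g\<close> constantly 1 gives
  \<open>hom_weight\<close>.\<close>

lemma sum_PiE_path:
  fixes g :: "nat \<Rightarrow> real"
  shows "(\<Sum>\<phi>\<in>{0..n} \<rightarrow>\<^sub>E {1..N}. (\<Prod>i<n. edge_weight A R i (\<phi> i) (\<phi> (Suc i))) * g (\<phi> n))
       = (\<Sum>x\<in>{1..N}. path_weight A N R n x * g x)"
proof (induction n arbitrary: g)
  case 0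
  have "{0..0::nat} = insert 0 {}" by auto
  then have "{0..0::nat} \<rightarrow>\<^sub>E {1..N} = (\<lambda>(y, f). f(0 := y)) ` ({1..N} \<times> ({} \<rightarrow>\<^sub>E {1..N}))"
    by (simp only: PiE_insert_eq)
  moreover have "inj_on (\<lambda>(y, f). f(0::nat := y)) ({1..N} \<times> ({} \<rightarrow>\<^sub>E {1..N}))"
    by (rule inj_combinator) simp
  ultimately have "(\<Sum>\<phi>\<in>{0..0::nat} \<rightarrow>\<^sub>E {1..N}. g (\<phi> 0))
      = (\<Sum>(y, f :: nat \<Rightarrow> nat)\<in>{1..N} \<times> ({} \<rightarrow>\<^sub>E {1..N}). g y)"
    by (simp only: sum.reindex) (simp add: case_prod_unfold)
  also have "\<dots> = (\<Sum>y\<in>{1..N}. g y)"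
    by (subst sum.cartesian_product[symmetric]) simp
  finally show ?case
    by simp
next
  case (Suc n)
  let ?X = "{1..N}" and ?F = "{0..n} \<rightarrow>\<^sub>E {1..N}" and ?e = "edge_weight A R"
  have "{0..Suc n} = insert (Suc n) {0..n}" by auto
  then have img: "{0..Suc n} \<rightarrow>\<^sub>E ?X = (\<lambda>(y, f). f(Suc n := y)) ` (?X \<times> ?F)"
    by (simp only: PiE_insert_eq)
  have inj: "inj_on (\<lambda>(y, f). f(Suc n := y)) (?X \<times> ?F)"
    by (rule inj_combinator) simp
  have "(\<Sum>\<phi>\<in>{0..Suc n} \<rightarrow>\<^sub>E ?X. (\<Prod>i<Suc n. ?e i (\<phi> i) (\<phi> (Suc i))) * g (\<phi> (Suc n)))
      = (\<Sum>(y, f)\<in>?X \<times> ?F. (\<Prod>i<n. ?e i (f i) (f (Suc i))) * ?e n (f n) y * g y)"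
    unfolding img by (subst sum.reindex[OF inj]) (auto intro!: sum.cong prod.cong)
  also have "\<dots> = (\<Sum>y\<in>?X. \<Sum>f\<in>?F. (\<Prod>i<n. ?e i (f i) (f (Suc i))) * ?e n (f n) y * g y)"
    by (simp add: sum.cartesian_product)
  also have "\<dots> = (\<Sum>f\<in>?F. (\<Prod>i<n. ?e i (f i) (f (Suc i))) * (\<Sum>y\<in>?X. ?e n (f n) y * g y))"
    by (subst sum.swap) (simp add: sum_distrib_left mult.assoc)
  also have "\<dots> = (\<Sum>x\<in>?X. path_weight A N R n x * (\<Sum>y\<in>?X. ?e n x y * g y))"
    by (rule Suc.IH)
  also have "\<dots> = (\<Sum>y\<in>?X. \<Sum>x\<in>?X. path_weight A N R n x * ?e n x y * g y)"
    by (subst sum.swap) (simp add: sum_distrib_left mult.assoc)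
  also have "\<dots> = (\<Sum>y\<in>?X. path_weight A N R (Suc n) y * g y)"
    by (simp add: sum_distrib_right)
  finally show ?case .
qed

lemma hom_weight_oriented_path:
  "hom_weight (oriented_path n R) N A = (\<Sum>x\<in>{1..N}. path_weight A N R n x)"
proof -
  let ?a = "\<lambda>i. if i \<in> R then (i, Suc i) else (Suc i, i)"
  have "inj_on ?a {..<n}"
    by (auto simp: inj_on_def split: if_splits)
  then have "(\<Prod>(x, y)\<in>?a ` {..<n}. A (\<phi> x) (\<phi> y)) = (\<Prod>i<n. edge_weight A R i (\<phi> i) (\<phi> (Suc i)))"
    for \<phi> :: "nat \<Rightarrow> nat"
    by (subst prod.reindex) (auto simp: edge_weight_def intro!: prod.cong)
  then show ?thesis
    using sum_PiE_path[where g = "\<lambda>_. 1"] by (simp add: hom_weight_def oriented_path_def)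
qed

section \<open>The transitive tournament on two vertices\<close>

definition transitive2 :: "nat \<Rightarrow> nat \<Rightarrow> real" where
  "transitive2 x y = (if x = y then 1/2 else if x < y then 1 else 0)"

definition wsum :: "nat set \<Rightarrow> nat \<Rightarrow> real" where
  "wsum R n = path_weight transitive2 2 R n 1 + path_weight transitive2 2 R n 2"

definition wdiff :: "nat set \<Rightarrow> nat \<Rightarrow> real" where
  "wdiff R n = path_weight transitive2 2 R n 2 - path_weight transitive2 2 R n 1"

lemma atLeastAtMost_1_2: "{1..2::nat} = {1, 2}"
  by auto

lemma wsum_0: "wsum R 0 = 2" and wdiff_0: "wdiff R 0 = 0"
  by (simp_all add: wsum_def wdiff_def)

text \<open>If n \<in> R, the weights (a, b) at the vertices 1 and 2 become (a/2, a + b/2).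
  Otherwise the two vertices exchange roles, which flips the sign of \<open>wdiff\<close>.\<close>

lemma wsum_Suc: "wsum R (Suc n) = wsum R n - (if n \<in> R then 1 else -1) * wdiff R n / 2"
  and wdiff_Suc: "wdiff R (Suc n) = (if n \<in> R then 1 else -1) * wsum R n / 2"
  unfolding wsum_def wdiff_def path_weight.simps atLeastAtMost_1_2
  by (simp_all add: edge_weight_def transitive2_def field_simps)

lemma wsum_cong: "R \<inter> {..<n} = S \<inter> {..<n} \<Longrightarrow> wsum R n = wsum S n"
  and wdiff_cong: "R \<inter> {..<n} = S \<inter> {..<n} \<Longrightarrow> wdiff R n = wdiff S n"
  unfolding wsum_def wdiff_def by (simp_all cong: path_weight_cong)

text \<open>Inductively, the new sum is at least P - |Q|/2 \<ge> P/2 > 0, and P/2 is the new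
  |Q|.\<close>

lemma wsum_pos_wdiff_le: "0 < wsum R n \<and> \<bar>wdiff R n\<bar> \<le> wsum R n"
  by (induction n) (auto simp: wsum_0 wdiff_0 wsum_Suc wdiff_Suc abs_if split: if_splits)

text \<open>The new sum is at most P + |Q|/2 \<le> 3P/2, which is three times the new |Q|.\<close>

lemma wdiff_ge: "wsum R (Suc n) / 3 \<le> \<bar>wdiff R (Suc n)\<bar>"
  using wsum_pos_wdiff_le[of R n]
  by (auto simp: wsum_Suc wdiff_Suc abs_if split: if_splits)

text \<open>With n + 1 vertices, n edges and N = 2, the Sidorenko bound is 2^(n+1) / 2^n =
  2.\<close>

lemma tournament_sidorenko_imp_wsum_ge:
  assumes "tournament_sidorenko (oriented_path n R)"
  shows "2 \<le> wsum R n"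
proof -
  have "weighted_tournament 2 transitive2"
    by (auto simp: weighted_tournament_def transitive2_def)
  with assms have "hom_weight (oriented_path n R) 2 transitive2
      \<ge> real 2 ^ card (pverts (oriented_path n R)) / 2 ^ card (parcs (oriented_path n R))"
    unfolding tournament_sidorenko_def by blast
  moreover have "card (pverts (oriented_path n R)) = Suc n"
    by (simp add: oriented_path_def)
  moreover have "hom_weight (oriented_path n R) 2 transitive2 = wsum R n"
    unfolding hom_weight_oriented_path atLeastAtMost_1_2 wsum_def by simp
  ultimately show ?thesis
    by (simp add: card_parcs_oriented_path)
qed

section \<open>Exponential decay of the mean square root\<close>

lemma sqrt_add_sqrt_le:
  fixes P Q :: real
  assumes "0 < P" "\<bar>Q\<bar> \<le> P" "P / 3 \<le> \<bar>Q\<bar>"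
  shows "sqrt (P - Q / 2) + sqrt (P + Q / 2) \<le> 2 * sqrt (143/144) * sqrt P"
proof -
  let ?a = "sqrt (P - Q / 2)" and ?b = "sqrt (P + Q / 2)"
  have nonneg: "0 \<le> P - Q / 2" "0 \<le> P + Q / 2"
    using assms(2) by linarith+
  have "(P / 3)\<^sup>2 \<le> \<bar>Q\<bar>\<^sup>2"
    using assms by (intro power_mono) auto
  then have "P\<^sup>2 \<le> 9 * Q\<^sup>2"
    by (simp add: power_divide)
  \<comment> \<open>Here 143/1296 = 4 (1 - (71/72)^2), so this is exactly what the bound P^2 - Q^2/4
    \<le> (71/72 P)^2 needs.\<close>
  then have "143 * P\<^sup>2 \<le> 1296 * Q\<^sup>2"
    using zero_le_power2[of Q] by linarith
  moreover have "(P - Q / 2) * (P + Q / 2) = P\<^sup>2 - Q\<^sup>2 / 4"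
    by (simp add: power2_eq_square field_simps)
  ultimately have "(P - Q / 2) * (P + Q / 2) \<le> (71/72 * P)\<^sup>2"
    by (simp add: power_mult_distrib power_divide)
  then have "?a * ?b \<le> 71/72 * P"
    unfolding real_sqrt_mult[symmetric] using assms(1) by (intro real_le_lsqrt) auto
  \<comment> \<open>The square is 2P + 2 \<open>?a * ?b\<close> \<le> 2P (1 + 71/72) = 4P *
    143/144.\<close>
  then have "(?a + ?b)\<^sup>2 \<le> (2 * sqrt (143/144) * sqrt P)\<^sup>2"
    using nonneg assms(1) by (simp add: power2_sum power_mult_distrib)
  then show ?thesis
    by (rule power2_le_imp_le) (use assms(1) in simp)
qed

lemma sum_Pow_lessThan_Suc:
  fixes f :: "nat set \<Rightarrow> real"
  shows "(\<Sum>R\<in>Pow {..<Suc n}. f R) = (\<Sum>R\<in>Pow {..<n}. f R + f (insert n R))"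
proof -
  have "inj_on (insert n) (Pow {..<n})"
    by (force simp: inj_on_def)
  moreover have "Pow {..<n} \<inter> insert n ` Pow {..<n} = {}"
    by auto
  ultimately show ?thesis
    by (simp add: lessThan_Suc Pow_insert sum.union_disjoint sum.reindex sum.distrib)
qed

text \<open>The count starts after the first edge: initially Q = 0, so that edge gives no gain and
  both its orientations have P = 2. From then on \<open>wdiff_ge\<close> applies, and each edge
  multiplies the sum by at most 2 \<open>sqrt (143/144)\<close>.\<close>

lemma sum_sqrt_wsum_le:
  "(\<Sum>R\<in>Pow {..<Suc n}. sqrt (wsum R (Suc n))) \<le> sqrt 2 * 2 * (2 * sqrt (143/144)) ^ n"
proof (induction n)
  case 0
  then show ?case
    by (simp add: card_Pow wsum_Suc wsum_0 wdiff_0)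
next
  case (Suc n)
  let ?m = "Suc n"
  have "sqrt (wsum R (Suc ?m)) + sqrt (wsum (insert ?m R) (Suc ?m))
      \<le> 2 * sqrt (143/144) * sqrt (wsum R ?m)" if "R \<in> Pow {..<?m}" for R
  proof -
    \<comment> \<open>Both extensions of the same initial orientation start from the same P and Q,
      so their new sums are P + Q/2 and P - Q/2.\<close>
    have "insert ?m R \<inter> {..<?m} = R \<inter> {..<?m}"
      by auto
    then have "wsum (insert ?m R) ?m = wsum R ?m" "wdiff (insert ?m R) ?m = wdiff R ?m"
      by (auto intro: wsum_cong wdiff_cong)
    moreover have "?m \<notin> R"
      using that by auto
    ultimately show ?thesis
      using sqrt_add_sqrt_le[of "wsum R ?m" "wdiff R ?m"] wsum_pos_wdiff_le[of R ?m] wdiff_ge[of R n]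
      by (simp add: wsum_Suc[of _ ?m] add.commute)
  qed
  then have "(\<Sum>R\<in>Pow {..<Suc ?m}. sqrt (wsum R (Suc ?m)))
      \<le> (\<Sum>R\<in>Pow {..<?m}. 2 * sqrt (143/144) * sqrt (wsum R ?m))"
    unfolding sum_Pow_lessThan_Suc[of _ ?m] by (rule sum_mono)
  also have "\<dots> = 2 * sqrt (143/144) * (\<Sum>R\<in>Pow {..<?m}. sqrt (wsum R ?m))"
    by (simp only: sum_distrib_left)
  also have "\<dots> \<le> 2 * sqrt (143/144) * (sqrt 2 * 2 * (2 * sqrt (143/144)) ^ n)"
    by (intro mult_left_mono Suc.IH) simp
  finally show ?case
    by (simp only: power_Suc mult_ac)
qed

text \<open>A Markov-type bound: each TS orientation contributes at least \<open>sqrt 2\<close> to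
  the sum of square roots, and the others contribute nonnegative amounts.\<close>

lemma card_tournament_sidorenko_le:
  "real (card {D \<in> path_orientations (Suc n). tournament_sidorenko D})
     \<le> 2 * (2 * sqrt (143/144)) ^ n"
proof -
  let ?m = "Suc n"
  let ?T = "{R \<in> Pow {..<?m}. tournament_sidorenko (oriented_path ?m R)}"
  have "{D \<in> path_orientations ?m. tournament_sidorenko D} = oriented_path ?m ` ?T"
    by (auto simp: path_orientations_def)
  moreover have "inj_on (oriented_path ?m) ?T"
    by (rule inj_on_subset[OF inj_on_oriented_path]) auto
  ultimately have "sqrt 2 * real (card {D \<in> path_orientations ?m. tournament_sidorenko D})
      = (\<Sum>R\<in>?T. sqrt 2)"
    by (simp add: card_image)
  also have "\<dots> \<le> (\<Sum>R\<in>?T. sqrt (wsum R ?m))"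
    using tournament_sidorenko_imp_wsum_ge by (intro sum_mono) auto
  also have "\<dots> \<le> (\<Sum>R\<in>Pow {..<?m}. sqrt (wsum R ?m))"
    using wsum_pos_wdiff_le by (intro sum_mono2) (auto intro: less_imp_le)
  also have "\<dots> \<le> sqrt 2 * (2 * (2 * sqrt (143/144)) ^ n)"
    using sum_sqrt_wsum_le[of n] by (simp only: mult.assoc)
  finally show ?thesis
    by (rule mult_left_le_imp_le) simp
qed

theorem theorem1p8:
  shows "(\<lambda>n. real (card {D \<in> path_orientations n. tournament_sidorenko D})
               / real (card (path_orientations n))) \<longlonglongrightarrow> 0"
proof -
  let ?f = "\<lambda>n. real (card {D \<in> path_orientations n. tournament_sidorenko D})
                 / real (card (path_orientations n))"
  have bound: "?f (Suc n) \<le> sqrt (143/144) ^ n" for n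
  proof -
    have "?f (Suc n) \<le> 2 * (2 * sqrt (143/144)) ^ n / 2 ^ Suc n"
      using card_tournament_sidorenko_le[of n]
      by (simp only: card_path_orientations of_nat_power of_nat_numeral divide_right_mono
          zero_le_power zero_le_numeral)
    \<comment> \<open>The factor 2 * 2^n cancels against the number of orientations, leaving a
      geometric sequence of ratio below 1.\<close>
    also have "\<dots> = sqrt (143/144) ^ n"
      by (simp only: power_mult_distrib) simp
    finally show ?thesis .
  qed
  have "(\<lambda>n. sqrt (143/144) ^ n) \<longlonglongrightarrow> 0"
    by (rule LIMSEQ_power_zero) simp
  then have "(\<lambda>n. ?f (Suc n)) \<longlonglongrightarrow> 0"
    by (rule tendsto_sandwich[OF _ _ tendsto_const, rotated 2]) (use bound in auto)
  then show ?thesis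
    by (rule LIMSEQ_imp_Suc)
qed

end
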